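(* Let $\Sigma=\{\mathcal{X}=(\xi,A),\Delta^L\}$ be a simple ARS on $G(\theta)$ with $A\neq 0$, let ${\bf u}\in\mathbb{R}^2$ be a nonzero vector normal to $l_\Delta$, and let $$F_{\bf u}:G(\theta)\to\mathbb{R},\qquad F_{\bf u}(t,v)=\langle\rho_{-t}(Av+\Lambda_t^\theta\xi),{\bf u}\rangle_{\mathbb{R}^2}.$$ Then the singular locus $\mathcal{Z}=\{(t,v)\in G(\theta):\ \mathcal{X}(t,v)\in\Delta^L(t,v)\}$ is connected. Moreover, $G(\theta)\setminus\mathcal{Z}$ has exactly two connected components, given by $$\mathcal{C}^-:=F_{\bf u}^{-1}(-\infty,0)\quad\text{and}\quad \mathcal{C}^+:=F_{\bf u}^{-1}(0,+\infty).$$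
   Context: Admissible matrices: $\theta$ is a real $2\times2$ matrix of one of the types $\begin{pmatrix}1&1\\0&1\end{pmatrix}$; $\begin{pmatrix}1&0\\0&\lambda\end{pmatrix}$ with $\lambda\in[-1,1]$; $\begin{pmatrix}\lambda&-1\\1&\lambda\end{pmatrix}$ with $\lambda\in\mathbb{R}$. $\mathfrak{g}(\theta)=\mathbb{R}\times_\theta\mathbb{R}^2$ is the 3-dimensional Lie algebra on $\mathbb{R}\times\mathbb{R}^2$ with bracket $[(a_1,w_1),(a_2,w_2)]=(0,\,a_1\theta w_2-a_2\theta w_1)$. $G(\theta)=\mathbb{R}\times_\rho\mathbb{R}^2$ is the connected, simply connected Lie group with Lie algebra $\mathfrak{g}(\theta)$ and product $(t_1,v_1)(t_2,v_2)=(t_1+t_2,\,v_1+\rho_{t_1}v_2)$, where $\rho_t=e^{t\theta}$. For a $2\times 2$ matrix $B$, $\Lambda^B_t w=\int_0^t e^{sB}w\,ds$. Linear vector fields: a vector field $\mathcal{X}$ on $G(\theta)$ is linear if it is complete and its flow is a 1-parameter group of automorphisms of $G(\theta)$. These are exactly the vector fields $\mathcal{X}(t,v)=(0,\,Av+\Lambda_t^\theta\xi)$ with $\xi\in\mathbb{R}^2$, $A\in\mathfrak{gl}(2,\mathbb{R})$, $A\theta=\theta A$; one writes $\mathcal{X}=(\xi,A)$. The associated derivation of $\mathfrak{g}(\theta)$ is $\mathcal{D}(a,w)=(0,\,a\xi+Aw)$. Left-invariant distributions: for a 2-dimensional subspace $\Delta\subset\mathfrak{g}(\theta)$, $\Delta^L(t,v)=(dL_{(t,v)})_{(0,0)}\Delta=\{(a,\rho_t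 w):(a,w)\in\Delta\}$. An inner product on $\Delta$ induces a left-invariant Euclidean metric on $\Delta^L$. LARC: $\Sigma=\{\mathcal{X},\Delta^L\}$ satisfies the Lie algebra rank condition (LARC) if either $\Delta$ is not a subalgebra of $\mathfrak{g}(\theta)$, or $\Delta$ is a subalgebra and $\mathcal{D}\Delta\not\subset\Delta$. Simple ARS: a simple ARS (also called just an ARS) on $G(\theta)$ is a family $\Sigma=\{\mathcal{X},\Delta^L\}$ with $\mathcal{X}$ a linear vector field and $\Delta^L$ a 2-dimensional left-invariant distribution with a left-invariant Euclidean metric, such that (i) $\{(t,v):\mathcal{X}(t,v)\notin\Delta^L(t,v)\}\neq\emptyset$ and (ii) $\Sigma$ satisfies the LARC. The line $l_\Delta$: the LARC forces $\Delta\neq\{0\}\times\mathbb{R}^2$, so $\Delta\cap(\{0\}\times\mathbb{R}^2)$ is one-dimensional, and $l_\Delta\subset\mathbb{R}^2$ is the line with $\{0\}\times l_\Delta=\Delta\cap(\{0\}\times\mathbb{R}^2)$. $\langle\cdot,\cdot\rangle_{\mathbb{R}^2}$ is the standard inner product of $\mathbb{R}^2$, with respect to which normality is understood. *)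

theory Defs
  imports "HOL-Analysis.Analysis"
begin

definition admissible :: "real^2^2 \<Rightarrow> bool" where
  "admissible \<theta> \<longleftrightarrow>
     \<theta> = vector [vector [1, 1], vector [0, 1]] \<or>
     (\<exists>l\<in>{-1..1}. \<theta> = vector [vector [1, 0], vector [0, l]]) \<or>
     (\<exists>l. \<theta> = vector [vector [l, -1], vector [1, l]])"

text \<open>The library's exponential needs a Banach algebra, which \<open>real^2^2\<close> with the matrix
  product is not (its \<open>*\<close> and \<open>^\<close> act entrywise), so the defining series is written out.\<close>

definition mat_exp :: "real^2^2 \<Rightarrow> real^2^2" where
  "mat_exp M = (\<Sum>k. (1 / fact k) *\<^sub>R (((**) M ^^ k) (mat 1)))"

definition rho :: "real^2^2 \<Rightarrow> real \<Rightarrow> real^2^2" where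
  "rho \<theta> t = mat_exp (t *\<^sub>R \<theta>)"

text \<open>The interval integral is oriented, so negative \<open>t\<close> gives minus the integral
  over \<open>[t, 0]\<close>.\<close>

definition Lam :: "real^2^2 \<Rightarrow> real \<Rightarrow> real^2 \<Rightarrow> real^2" where
  "Lam B t w = (LBINT s=0..ereal t. mat_exp (s *\<^sub>R B) *v w)"

text \<open>The type \<open>real \<times> (real^2)\<close> carries both the Lie algebra \<open>\<gg>(\<theta>)\<close> and the
  group \<open>G(\<theta>)\<close>. Tangent spaces of the group are identified with \<open>real \<times> (real^2)\<close> through
  the global coordinates, so a vector field is a function from this type to itself.\<close>

type_synonym plane_ext = "real \<times> (real^2)"

definition lie_bracket :: "real^2^2 \<Rightarrow> plane_ext \<Rightarrow> plane_ext \<Rightarrow> plane_ext" where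
  "lie_bracket \<theta> X Y = (0, fst X *\<^sub>R (\<theta> *v snd Y) - fst Y *\<^sub>R (\<theta> *v snd X))"

definition group_mult :: "real^2^2 \<Rightarrow> plane_ext \<Rightarrow> plane_ext \<Rightarrow> plane_ext" where
  "group_mult \<theta> p q = (fst p + fst q, snd p + rho \<theta> (fst p) *v snd q)"

text \<open>Continuous homomorphisms between Lie groups are smooth, so the homeomorphic group
  automorphisms are exactly the Lie group automorphisms.\<close>

definition group_automorphism :: "real^2^2 \<Rightarrow> (plane_ext \<Rightarrow> plane_ext) \<Rightarrow> bool" where
  "group_automorphism \<theta> f \<longleftrightarrow>
     (\<exists>h. homeomorphism UNIV UNIV f h) \<and>
     (\<forall>p q. f (group_mult \<theta> p q) = group_mult \<theta> (f p) (f q))"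

text \<open>Completeness is expressed by the flow \<open>\<phi>\<close> being defined for all times.\<close>

definition linear_vector_field :: "real^2^2 \<Rightarrow> (plane_ext \<Rightarrow> plane_ext) \<Rightarrow> bool" where
  "linear_vector_field \<theta> X \<longleftrightarrow>
     (\<exists>\<phi> :: real \<Rightarrow> plane_ext \<Rightarrow> plane_ext.
        \<phi> 0 = id \<and> (\<forall>r s. \<phi> (r + s) = \<phi> r \<circ> \<phi> s) \<and>
        (\<forall>s p. ((\<lambda>s. \<phi> s p) has_vector_derivative X (\<phi> s p)) (at s)) \<and>
        (\<forall>s. group_automorphism \<theta> (\<phi> s)))"

text \<open>The vector field written \<open>(\<xi>, A)\<close>, and its associated derivation.\<close>

definition lin_field :: "real^2^2 \<Rightarrow> real^2 \<Rightarrow> real^2^2 \<Rightarrow> plane_ext \<Rightarrow> plane_ext" where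
  "lin_field \<theta> \<xi> A p = (0, A *v snd p + Lam \<theta> (fst p) \<xi>)"

definition lin_deriv :: "real^2 \<Rightarrow> real^2^2 \<Rightarrow> plane_ext \<Rightarrow> plane_ext" where
  "lin_deriv \<xi> A X = (0, fst X *\<^sub>R \<xi> + A *v snd X)"

text \<open>The differential at the identity of the left translation by \<open>(t, v)\<close> is
  \<open>(a, w) \<mapsto> (a, \<rho>\<^sub>t w)\<close>.\<close>

definition left_dist :: "real^2^2 \<Rightarrow> plane_ext set \<Rightarrow> plane_ext \<Rightarrow> plane_ext set" where
  "left_dist \<theta> \<Delta> p = (\<lambda>(a, w). (a, rho \<theta> (fst p) *v w)) ` \<Delta>"

definition subalgebra :: "real^2^2 \<Rightarrow> plane_ext set \<Rightarrow> bool" where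
  "subalgebra \<theta> \<Delta> \<longleftrightarrow> subspace \<Delta> \<and> (\<forall>X\<in>\<Delta>. \<forall>Y\<in>\<Delta>. lie_bracket \<theta> X Y \<in> \<Delta>)"

definition larc :: "real^2^2 \<Rightarrow> real^2 \<Rightarrow> real^2^2 \<Rightarrow> plane_ext set \<Rightarrow> bool" where
  "larc \<theta> \<xi> A \<Delta> \<longleftrightarrow>
     \<not> subalgebra \<theta> \<Delta> \<or> (subalgebra \<theta> \<Delta> \<and> \<not> lin_deriv \<xi> A ` \<Delta> \<subseteq> \<Delta>)"

text \<open>Only the values of \<open>g\<close> on \<open>\<Delta>\<close> are relevant.\<close>

definition inner_product_on :: "plane_ext set \<Rightarrow> (plane_ext \<Rightarrow> plane_ext \<Rightarrow> real) \<Rightarrow> bool" where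
  "inner_product_on \<Delta> g \<longleftrightarrow>
     (\<forall>x\<in>\<Delta>. \<forall>y\<in>\<Delta>. g x y = g y x) \<and>
     (\<forall>x\<in>\<Delta>. \<forall>y\<in>\<Delta>. \<forall>z\<in>\<Delta>. g (x + y) z = g x z + g y z) \<and>
     (\<forall>x\<in>\<Delta>. \<forall>y\<in>\<Delta>. \<forall>c. g (c *\<^sub>R x) y = c * g x y) \<and>
     (\<forall>x\<in>\<Delta>. x \<noteq> 0 \<longrightarrow> g x x > 0)"

definition singular_locus ::
  "real^2^2 \<Rightarrow> real^2 \<Rightarrow> real^2^2 \<Rightarrow> plane_ext set \<Rightarrow> plane_ext set" where
  "singular_locus \<theta> \<xi> A \<Delta> = {p. lin_field \<theta> \<xi> A p \<in> left_dist \<theta> \<Delta> p}"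

text \<open>A simple ARS \<open>{X, \<Delta>\<^sup>L}\<close> with \<open>X = (\<xi>, A)\<close>. The left-invariant distribution and its
  left-invariant metric are given by their values \<open>\<Delta>\<close> and \<open>g\<close> at the identity. The
  fields \<open>(\<xi>, A)\<close> with \<open>A\<close> commuting with \<open>\<theta>\<close> are exactly the linear ones, so the
  first two conjuncts are not independent: the first implies the second.\<close>

definition simple_ars ::
  "real^2^2 \<Rightarrow> real^2 \<Rightarrow> real^2^2 \<Rightarrow> plane_ext set \<Rightarrow> (plane_ext \<Rightarrow> plane_ext \<Rightarrow> real) \<Rightarrow> bool" where
  "simple_ars \<theta> \<xi> A \<Delta> g \<longleftrightarrow>
     A ** \<theta> = \<theta> ** A \<and> linear_vector_field \<theta> (lin_field \<theta> \<xi> A) \<and>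
     subspace \<Delta> \<and> dim \<Delta> = 2 \<and> inner_product_on \<Delta> g \<and>
     {p. lin_field \<theta> \<xi> A p \<notin> left_dist \<theta> \<Delta> p} \<noteq> {} \<and>
     larc \<theta> \<xi> A \<Delta>"

definition l_line :: "plane_ext set \<Rightarrow> (real^2) set" where
  "l_line \<Delta> = {w. (0, w) \<in> \<Delta>}"

definition F_fun :: "real^2^2 \<Rightarrow> real^2 \<Rightarrow> real^2^2 \<Rightarrow> real^2 \<Rightarrow> plane_ext \<Rightarrow> real" where
  "F_fun \<theta> \<xi> A u p =
     (rho \<theta> (- fst p) *v (A *v snd p + Lam \<theta> (fst p) \<xi>)) \<bullet> u"

end

theory Submission
  imports Defs
begin

text \<open>The singular locus is the zero set of \<open>F\<^sub>u\<close>, because \<open>l\<^sub>\<Delta>\<close> is the whole orthogonal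
  complement of \<open>u\<close>. If \<open>A\<^sup>T u\<close> is nonzero, then in the coordinates \<open>(t, w)\<close> with
  \<open>w = \<rho>\<^sub>-\<^sub>t v\<close> one has \<open>F\<^sub>u = \<langle>w, A\<^sup>T u\<rangle> + c(t)\<close>, whose zero set is a graph and whose
  positive and negative sets are the two sides of it. If \<open>A\<^sup>T u = 0\<close>, then \<open>A\<close> has rank one with
  range \<open>u\<^sup>\<bottom>\<close>; this range is \<open>\<theta>\<close>-invariant, so \<open>\<theta>\<^sup>T u = \<mu> u\<close>. Then \<open>\<Delta>\<close> is a
  subalgebra, and the rank condition forces \<open>\<langle>\<xi>, u\<rangle> \<noteq> 0\<close>. Hence \<open>\<langle>\<Lambda>\<^sub>t \<xi>, u\<rangle>\<close>, with
  derivative \<open>e\<^bsup>t\<mu>\<^esup> \<langle>\<xi>, u\<rangle>\<close>, is strictly monotone and vanishes at \<open>0\<close>, and the sign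
  of \<open>F\<^sub>u\<close> is that of \<open>\<plusminus>t\<close>.\<close>

section \<open>The matrix exponential: series, commutation, derivative and inverse\<close>

definition mat_pow :: "real^2^2 \<Rightarrow> nat \<Rightarrow> real^2^2" where
  "mat_pow M k = ((**) M ^^ k) (mat 1)"

lemma mat_pow_0 [simp]: "mat_pow M 0 = mat 1"
  by (simp add: mat_pow_def)

lemma mat_pow_Suc [simp]: "mat_pow M (Suc k) = M ** mat_pow M k"
  by (simp add: mat_pow_def)

lemma bounded_bilinear_matrix_mult:
  "bounded_bilinear ((**) :: real^2^2 \<Rightarrow> real^2^2 \<Rightarrow> real^2^2)"
  unfolding bilinear_conv_bounded_bilinear [symmetric] bilinear_def
  by (auto intro!: linearI
      simp: matrix_matrix_mult_def vec_eq_iff sum_2 algebra_simps)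

lemma bounded_bilinear_matrix_vector_mult:
  "bounded_bilinear ((*v) :: real^2^2 \<Rightarrow> real^2 \<Rightarrow> real^2)"
  unfolding bilinear_conv_bounded_bilinear [symmetric] bilinear_def
  by (auto intro!: linearI simp: matrix_vector_right_distrib matrix_vector_mult_add_rdistrib
      scaleR_matrix_vector_assoc matrix_vector_mult_scaleR)

lemma mat_pow_scaleR: "mat_pow (t *\<^sub>R M) k = t ^ k *\<^sub>R mat_pow M k"
proof (induction k)
  case (Suc k)
  have "mat_pow (t *\<^sub>R M) (Suc k) = (t *\<^sub>R M) ** (t ^ k *\<^sub>R mat_pow M k)"
    by (simp add: Suc)
  also have "\<dots> = t ^ Suc k *\<^sub>R mat_pow M (Suc k)"
    using bounded_bilinear.scaleR_left [OF bounded_bilinear_matrix_mult]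
      bounded_bilinear.scaleR_right [OF bounded_bilinear_matrix_mult] by simp
  finally show ?case .
qed simp

lemma rho_eq_suminf: "rho \<theta> t = (\<Sum>k. (t ^ k / fact k) *\<^sub>R mat_pow \<theta> k)"
  by (simp add: rho_def mat_exp_def mat_pow_scaleR flip: mat_pow_def)

text \<open>Left multiplication by \<open>\<theta>\<close> has a bound \<open>K\<close>, so the
  powers grow at most like \<open>K ^ k\<close> and the exponential series of
  \<open>\<bar>t\<bar> * K\<close> dominates.\<close>

lemma summable_rho: "summable (\<lambda>k. (t ^ k / fact k) *\<^sub>R mat_pow \<theta> k)"
proof -
  have "bounded_linear ((**) \<theta> :: real^2^2 \<Rightarrow> real^2^2)"
    by (rule bounded_bilinear.bounded_linear_right [OF bounded_bilinear_matrix_mult])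
  then obtain K where K: "K > 0" "\<And>X :: real^2^2. norm (\<theta> ** X) \<le> norm X * K"
    using bounded_linear.pos_bounded by blast
  have bound: "norm (mat_pow \<theta> k) \<le> norm (mat 1 :: real^2^2) * K ^ k" for k
  proof (induction k)
    case (Suc k)
    have "norm (mat_pow \<theta> (Suc k)) \<le> norm (mat_pow \<theta> k) * K"
      using K by simp
    also have "\<dots> \<le> (norm (mat 1 :: real^2^2) * K ^ k) * K"
      using Suc K by (intro mult_right_mono) auto
    finally show ?case by (simp add: mult_ac)
  qed simp
  have "summable (\<lambda>k. norm (mat 1 :: real^2^2) * (inverse (fact k) * (\<bar>t\<bar> * K) ^ k))"
    by (intro summable_mult summable_exp)
  then show ?thesis
  proof (rule summable_comparison_test')
    fix k :: nat
    have "norm ((t ^ k / fact k) *\<^sub>R mat_pow \<theta> k) = \<bar>t\<bar> ^ k / fact k * norm (mat_pow \<theta> k)"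
      by (simp add: power_abs)
    also have "\<dots> \<le> \<bar>t\<bar> ^ k / fact k * (norm (mat 1 :: real^2^2) * K ^ k)"
      using bound by (intro mult_left_mono) auto
    finally show "norm ((t ^ k / fact k) *\<^sub>R mat_pow \<theta> k)
        \<le> norm (mat 1 :: real^2^2) * (inverse (fact k) * (\<bar>t\<bar> * K) ^ k)"
      by (simp only: power_mult_distrib divide_inverse mult_ac)
  qed
qed

text \<open>Identities about \<open>rho\<close> are obtained by pushing a bounded linear map through
  the series and comparing terms.\<close>

lemma bounded_linear_rho_sums:
  assumes "bounded_linear L"
  shows "(\<lambda>k. (t ^ k / fact k) *\<^sub>R L (mat_pow \<theta> k)) sums L (rho \<theta> t)"
proof -
  interpret bounded_linear L by fact
  show ?thesis
    using sums [OF summable_sums [OF summable_rho]] by (simp add: rho_eq_suminf scaleR)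
qed

lemma rho_0 [simp]: "rho \<theta> 0 = mat 1"
proof -
  have "(\<lambda>k. (0 ^ k / fact k) *\<^sub>R mat_pow \<theta> k) sums rho \<theta> 0"
    using bounded_linear_rho_sums [OF bounded_linear_ident] .
  \<comment> \<open>Since \<open>0 ^ 0 = 1\<close>, exactly the term \<open>k = 0\<close>
    survives.\<close>
  moreover have "(\<lambda>k. (0 ^ k / fact k) *\<^sub>R mat_pow \<theta> k) =
      (\<lambda>k. if k = 0 then mat_pow \<theta> k else 0)"
    by (auto simp: fun_eq_iff)
  ultimately show ?thesis
    using sums_single [of 0 "mat_pow \<theta>"] by (simp add: sums_unique2)
qed

lemma rho_commute:
  assumes "A ** \<theta> = \<theta> ** A"
  shows "A ** rho \<theta> t = rho \<theta> t ** A"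
proof -
  have pow: "A ** mat_pow \<theta> k = mat_pow \<theta> k ** A" for k
    by (induction k) (simp_all, metis assms matrix_mul_assoc)
  have "(\<lambda>k. (t ^ k / fact k) *\<^sub>R (A ** mat_pow \<theta> k)) sums (A ** rho \<theta> t)"
    by (intro bounded_linear_rho_sums
        bounded_bilinear.bounded_linear_right [OF bounded_bilinear_matrix_mult])
  moreover have "(\<lambda>k. (t ^ k / fact k) *\<^sub>R (mat_pow \<theta> k ** A)) sums (rho \<theta> t ** A)"
    by (intro bounded_linear_rho_sums
        bounded_bilinear.bounded_linear_left [OF bounded_bilinear_matrix_mult])
  ultimately show ?thesis
    by (simp add: pow sums_unique2)
qed

text \<open>Each coordinate is an everywhere convergent real power series, which may be
  differentiated term by term.\<close>

lemma rho_has_vector_derivative: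
  "(rho \<theta> has_vector_derivative \<theta> ** rho \<theta> t) (at t within S)"
proof -
  have "((\<lambda>t. rho \<theta> t \<bullet> b) has_field_derivative (\<theta> ** rho \<theta> t) \<bullet> b) (at t)" for b
  proof -
    define c where "c k = (mat_pow \<theta> k \<bullet> b) / fact k" for k
    have sums: "(\<lambda>k. c k * s ^ k) sums (rho \<theta> s \<bullet> b)" for s
      using bounded_linear_rho_sums [OF bounded_linear_inner_left, of s \<theta> b]
      by (simp add: c_def mult_ac)
    have "(\<lambda>k. (t ^ k / fact k) *\<^sub>R ((\<theta> ** mat_pow \<theta> k) \<bullet> b)) sums ((\<theta> ** rho \<theta> t) \<bullet> b)"
      by (intro bounded_linear_rho_sums bounded_linear_compose [OF bounded_linear_inner_left]
          bounded_bilinear.bounded_linear_right [OF bounded_bilinear_matrix_mult])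
    \<comment> \<open>The factor \<open>Suc k\<close> reduces \<open>fact (Suc k)\<close> to
      \<open>fact k\<close>; the raised index leaves one extra \<open>\<theta>\<close> on the
      left.\<close>
    moreover have "diffs c k * t ^ k = (t ^ k / fact k) *\<^sub>R ((\<theta> ** mat_pow \<theta> k) \<bullet> b)" for k
      by (simp add: diffs_def c_def divide_simps)
    ultimately have "(\<Sum>k. diffs c k * t ^ k) = (\<theta> ** rho \<theta> t) \<bullet> b"
      by (simp add: sums_iff)
    moreover have "((\<lambda>s. \<Sum>k. c k * s ^ k) has_field_derivative (\<Sum>k. diffs c k * t ^ k)) (at t)"
      using sums by (intro termdiffs_strong_converges_everywhere) (auto simp: sums_iff)
    moreover have "(\<lambda>s. \<Sum>k. c k * s ^ k) = (\<lambda>s. rho \<theta> s \<bullet> b)"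
      using sums by (auto simp: sums_iff)
    ultimately show ?thesis by simp
  qed
  then have "(rho \<theta> has_vector_derivative \<theta> ** rho \<theta> t) (at t)"
    unfolding has_vector_derivative_def
    by (subst has_derivative_componentwise_within)
      (simp add: has_field_derivative_def mult_commute_abs)
  then show ?thesis
    by (rule has_vector_derivative_at_within)
qed

lemma continuous_on_rho: "continuous_on S (rho \<theta>)"
  unfolding continuous_on_eq_continuous_within
  by (intro ballI has_vector_derivative_continuous [OF rho_has_vector_derivative])

text \<open>The two terms of the product rule cancel because \<open>\<theta>\<close> commutes with
  \<open>rho \<theta> (- t)\<close>, so the product keeps its value at \<open>0\<close>.\<close>

lemma rho_minus_mult: "rho \<theta> (- t) ** rho \<theta> t = mat 1"
proof -
  have "((\<lambda>t. rho \<theta> (- t) ** rho \<theta> t) has_vector_derivative 0) (at s within UNIV)" for s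
  proof -
    have "((\<lambda>t. rho \<theta> (- t)) has_vector_derivative (- 1) *\<^sub>R (\<theta> ** rho \<theta> (- s))) (at s within UNIV)"
      using vector_diff_chain_within [of uminus "-1" s UNIV "rho \<theta>" "\<theta> ** rho \<theta> (- s)"]
      by (simp add: o_def rho_has_vector_derivative has_vector_derivative_minus
          has_vector_derivative_id)
    note D = bounded_bilinear.has_vector_derivative
      [OF bounded_bilinear_matrix_mult this rho_has_vector_derivative]
    have "rho \<theta> (- s) ** (\<theta> ** rho \<theta> s) + ((- 1) *\<^sub>R (\<theta> ** rho \<theta> (- s))) ** rho \<theta> s = 0"
      using rho_commute [of \<theta> \<theta> "- s"]
        bounded_bilinear.minus_left [OF bounded_bilinear_matrix_mult]
      by (simp add: matrix_mul_assoc)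
    with D [of \<theta>] show ?thesis by metis
  qed
  then obtain c where "\<And>t. rho \<theta> (- t) ** rho \<theta> t = c"
    using has_vector_derivative_zero_constant
      [OF convex_UNIV, of "\<lambda>t. rho \<theta> (- t) ** rho \<theta> t"] by auto
  from this [of t] this [of 0] show ?thesis by simp
qed

lemma rho_minus_mult_vec [simp]: "rho \<theta> (- t) *v (rho \<theta> t *v w) = w"
  by (simp add: matrix_vector_mul_assoc rho_minus_mult)

lemma rho_mult_minus_vec [simp]: "rho \<theta> t *v (rho \<theta> (- t) *v w) = w"
  using rho_minus_mult_vec [of \<theta> "- t"] by simp

text \<open>Here \<open>u\<close> is an eigenvector of \<open>transpose \<theta>\<close>, hence of
  every transposed power, and the matrix series collapses to a scalar exponential.\<close>

lemma rho_inner_eigen: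
  assumes "\<And>w. (\<theta> *v w) \<bullet> u = \<mu> * (w \<bullet> u)"
  shows "(rho \<theta> t *v w) \<bullet> u = exp (t * \<mu>) * (w \<bullet> u)"
proof -
  have pow: "(mat_pow \<theta> k *v w) \<bullet> u = \<mu> ^ k * (w \<bullet> u)" for k
    by (induction k) (simp_all add: assms flip: matrix_vector_mul_assoc)
  have "(\<lambda>k. (t ^ k / fact k) *\<^sub>R ((mat_pow \<theta> k *v w) \<bullet> u)) sums ((rho \<theta> t *v w) \<bullet> u)"
    by (intro bounded_linear_rho_sums bounded_linear_compose [OF bounded_linear_inner_left]
        bounded_bilinear.bounded_linear_left [OF bounded_bilinear_matrix_vector_mult])
  moreover have "(\<lambda>k. ((t * \<mu>) ^ k /\<^sub>R fact k) * (w \<bullet> u)) sums (exp (t * \<mu>) * (w \<bullet> u))"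
    by (intro sums_mult2 exp_converges)
  moreover have "(t ^ k / fact k) *\<^sub>R ((mat_pow \<theta> k *v w) \<bullet> u) =
      ((t * \<mu>) ^ k /\<^sub>R fact k) * (w \<bullet> u)" for k
    by (simp add: pow power_mult_distrib field_simps)
  ultimately show ?thesis
    by (simp add: sums_unique2)
qed

section \<open>The integral \<open>Lam\<close> as an antiderivative\<close>

lemma Lam_0 [simp]: "Lam \<theta> 0 \<xi> = 0"
  by (simp add: Lam_def zero_ereal_def [symmetric])

lemma Lam_has_vector_derivative:
  "((\<lambda>t. Lam \<theta> t \<xi>) has_vector_derivative rho \<theta> t *v \<xi>) (at t)"
proof -
  \<comment> \<open>The interval \<open>{-b..b}\<close> contains the base point \<open>0\<close> and
    has \<open>t\<close> in its interior, so the derivative within it is two-sided.\<close>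
  define b where "b = \<bar>t\<bar> + 1"
  have cont: "continuous_on {-b..b} (\<lambda>s. rho \<theta> s *v \<xi>)"
    by (intro bounded_linear.continuous_on [OF bounded_bilinear.bounded_linear_left
          [OF bounded_bilinear_matrix_vector_mult]] continuous_on_rho)
  have "((\<lambda>t. Lam \<theta> t \<xi>) has_vector_derivative rho \<theta> t *v \<xi>) (at t within {-b..b})"
    using interval_integral_FTC2 [of "-b" 0 b "\<lambda>s. rho \<theta> s *v \<xi>" t] cont
    by (simp add: b_def Lam_def rho_def zero_ereal_def [symmetric])
  moreover have "at t within {-b..b} = at t"
    by (rule at_within_interior) (auto simp: b_def)
  ultimately show ?thesis by simp
qed

section \<open>The line of \<open>\<Delta>\<close>, and the singular locus as a zero set\<close>

lemma parallel_if_orthogonal: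
  fixes e u w :: "real^2"
  assumes "u \<noteq> 0" "e \<noteq> 0" "e \<bullet> u = 0" "w \<bullet> u = 0"
  obtains c where "w = c *\<^sub>R e"
proof -
  have *: "e$1 * u$1 + e$2 * u$2 = 0" "w$1 * u$1 + w$2 * u$2 = 0"
    using assms by (simp_all add: inner_vec_def sum_2)
  have "u$1 * (w$1 * e$2 - w$2 * e$1) = 0" "u$2 * (w$1 * e$2 - w$2 * e$1) = 0"
    using * by algebra+
  then have cross: "w$1 * e$2 = w$2 * e$1"
    using assms(1) by (auto simp: vec_eq_iff forall_2)
  show ?thesis
  proof (cases "e$1 = 0")
    case True
    then have "e$2 \<noteq> 0" using assms(2) by (auto simp: vec_eq_iff forall_2)
    with True cross have "w = (w$2 / e$2) *\<^sub>R e" by (auto simp: vec_eq_iff forall_2)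
    then show ?thesis by (rule that)
  next
    case False
    with cross have "w = (w$1 / e$1) *\<^sub>R e" by (auto simp: vec_eq_iff forall_2 field_simps)
    then show ?thesis by (rule that)
  qed
qed

text \<open>A plane in a 3-dimensional space contains some \<open>(0, e)\<close> with
  \<open>e\<close> nonzero; being normal to \<open>u\<close>, this \<open>e\<close> already spans
  the orthogonal complement of \<open>u\<close>.\<close>

lemma l_line_eq_orthogonal:
  assumes sub: "subspace \<Delta>" and dim: "dim \<Delta> = 2"
    and u: "u \<noteq> 0" and normal: "\<forall>w\<in>l_line \<Delta>. w \<bullet> u = 0"
  shows "l_line \<Delta> = {w. w \<bullet> u = 0}"
proof -
  have not_line: "\<not> \<Delta> \<subseteq> span {p}" for p
    using dim_le_card [of \<Delta> "{p}"] dim by auto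
  obtain e where e: "(0, e) \<in> \<Delta>" "e \<noteq> 0"
  proof (cases "\<exists>p\<in>\<Delta>. fst p \<noteq> 0")
    case True
    then obtain p where p: "p \<in> \<Delta>" "fst p \<noteq> 0" by auto
    obtain q where q: "q \<in> \<Delta>" "q \<notin> span {p}" using not_line by blast
    \<comment> \<open>Elimination of the first coordinate; \<open>r\<close> is nonzero because
      \<open>q\<close> is not a multiple of \<open>p\<close>.\<close>
    define r where "r = q - (fst q / fst p) *\<^sub>R p"
    have "r \<in> \<Delta>" unfolding r_def using sub p q by (intro subspace_diff subspace_scale)
    moreover have "fst r = 0" using p by (simp add: r_def)
    moreover have "r \<noteq> 0" using q by (auto simp: r_def span_singleton)
    ultimately show ?thesis using that [of "snd r"] by (cases r) (auto simp: zero_prod_def)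
  next
    case False
    moreover obtain q where "q \<in> \<Delta>" "q \<notin> span {0}" using not_line by blast
    ultimately have "fst q = 0" "q \<in> \<Delta>" "q \<noteq> 0" by auto
    then show ?thesis using that [of "snd q"] by (cases q) (simp add: zero_prod_def)
  qed
  show ?thesis
  proof
    show "{w. w \<bullet> u = 0} \<subseteq> l_line \<Delta>"
    proof clarify
      fix w assume w: "w \<bullet> u = 0"
      have "e \<bullet> u = 0" using normal e by (simp add: l_line_def)
      then obtain c where "w = c *\<^sub>R e"
        using parallel_if_orthogonal u e w by metis
      then show "w \<in> l_line \<Delta>"
        using subspace_scale [OF sub e(1), of c] by (simp add: l_line_def)
    qed
  qed (use normal in auto)
qed

text \<open>A linear field has first component \<open>0\<close>, so only vectors
  \<open>(0, w)\<close> of \<open>\<Delta>\<close> can match it; the inverse of \<open>rho\<close>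
  moves the condition to the identity.\<close>

lemma singular_locus_eq_zeros:
  assumes "l_line \<Delta> = {w. w \<bullet> u = 0}"
  shows "singular_locus \<theta> \<xi> A \<Delta> = F_fun \<theta> \<xi> A u -` {0}"
proof (rule set_eqI)
  fix p
  define x where "x = A *v snd p + Lam \<theta> (fst p) \<xi>"
  have "p \<in> singular_locus \<theta> \<xi> A \<Delta> \<longleftrightarrow> (\<exists>w. (0, w) \<in> \<Delta> \<and> x = rho \<theta> (fst p) *v w)"
    by (force simp: singular_locus_def left_dist_def lin_field_def x_def)
  also have "\<dots> \<longleftrightarrow> rho \<theta> (- fst p) *v x \<in> l_line \<Delta>"
    unfolding l_line_def by (metis mem_Collect_eq rho_minus_mult_vec rho_mult_minus_vec)
  also have "\<dots> \<longleftrightarrow> p \<in> F_fun \<theta> \<xi> A u -` {0}"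
    by (simp add: assms F_fun_def x_def)
  finally show "p \<in> singular_locus \<theta> \<xi> A \<Delta> \<longleftrightarrow> p \<in> F_fun \<theta> \<xi> A u -` {0}" .
qed

section \<open>Continuity and form of \<open>F_fun\<close>; the case
  \<open>transpose A *v u \<noteq> 0\<close>\<close>

lemma continuous_on_Lam: "continuous_on S (\<lambda>t. Lam \<theta> t \<xi>)"
  unfolding continuous_on_eq_continuous_within
  by (intro ballI has_vector_derivative_continuous [OF has_vector_derivative_at_within
        [OF Lam_has_vector_derivative]])

lemma continuous_on_rho_mult_vec [continuous_intros]:
  assumes "continuous_on S f" "continuous_on S h"
  shows "continuous_on S (\<lambda>x. rho \<theta> (f x) *v h x)"
  by (intro bounded_bilinear.continuous_on [OF bounded_bilinear_matrix_vector_mult] assms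
      continuous_on_compose2 [OF continuous_on_rho [of UNIV]]) auto

lemma continuous_on_Lam_compose [continuous_intros]:
  assumes "continuous_on S f"
  shows "continuous_on S (\<lambda>x. Lam \<theta> (f x) \<xi>)"
  by (intro assms continuous_on_compose2 [OF continuous_on_Lam [of UNIV]]) auto

lemma continuous_on_F_fun: "continuous_on S (F_fun \<theta> \<xi> A u)"
  unfolding F_fun_def
  by (intro continuous_intros bounded_linear.continuous_on [OF matrix_vector_mul_bounded_linear])

lemma inner_transpose: "(A *v w) \<bullet> u = w \<bullet> (transpose A *v u)" for A :: "real^'n^'m"
  by (metis dot_lmul_matrix inner_commute transpose_matrix_vector)

text \<open>As \<open>A\<close> commutes with \<open>rho\<close>, for fixed \<open>t\<close> the
  function is affine in \<open>rho \<theta> (- t) *v v\<close>; its gradient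
  \<open>transpose A *v u\<close> decides the case distinction.\<close>

lemma F_fun_eq:
  assumes "A ** \<theta> = \<theta> ** A"
  shows "F_fun \<theta> \<xi> A u (t, v) =
    (rho \<theta> (- t) *v v) \<bullet> (transpose A *v u) + (rho \<theta> (- t) *v Lam \<theta> t \<xi>) \<bullet> u"
proof -
  have "rho \<theta> (- t) *v (A *v v) = A *v (rho \<theta> (- t) *v v)"
    using rho_commute [OF assms] by (simp add: matrix_vector_mul_assoc)
  then show ?thesis
    by (simp only: F_fun_def fst_conv snd_conv matrix_vector_right_distrib inner_add_left
        inner_transpose)
qed

text \<open>The preimage is a continuous image of the connected set
  \<open>UNIV \<times> UNIV \<times> J\<close>, so one argument serves the zero set and both
  sides.\<close>

lemma connected_vimage_F_fun_regular:
  assumes comm: "A ** \<theta> = \<theta> ** A" and m: "transpose A *v u \<noteq> 0"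
    and J: "connected J" "J \<noteq> {}"
  shows "connected (F_fun \<theta> \<xi> A u -` J)" "F_fun \<theta> \<xi> A u -` J \<noteq> {}"
proof -
  define m where "m = transpose A *v u"
  define c where "c t = (rho \<theta> (- t) *v Lam \<theta> t \<xi>) \<bullet> u" for t
  define P where "P = (\<lambda>(t, w, r).
    (t :: real, rho \<theta> t *v (w + ((r - c t - w \<bullet> m) / (m \<bullet> m)) *\<^sub>R m)))"
  \<comment> \<open>\<open>P (t, w, r)\<close> moves \<open>w\<close> along \<open>m\<close> to reach the value \<open>r\<close> of \<open>F\<^sub>u\<close>.\<close>
  have mm: "m \<bullet> m \<noteq> 0" using m by (simp add: m_def)
  have F: "F_fun \<theta> \<xi> A u (t, v) = (rho \<theta> (- t) *v v) \<bullet> m + c t" for t v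
    by (simp add: F_fun_eq [OF comm] m_def c_def)
  have "continuous_on UNIV P"
    unfolding P_def split_def c_def using mm by (intro continuous_intros) auto
  then have "connected (P ` (UNIV \<times> UNIV \<times> J))"
    using J by (intro connected_continuous_image connected_Times connected_UNIV)
      (rule continuous_on_subset, auto)
  moreover have img: "F_fun \<theta> \<xi> A u -` J = P ` (UNIV \<times> UNIV \<times> J)"
  proof (intro equalityI subsetI)
    fix p assume p: "p \<in> F_fun \<theta> \<xi> A u -` J"
    obtain t v where tv: "p = (t, v)" by (cases p)
    have "p = P (t, rho \<theta> (- t) *v v, F_fun \<theta> \<xi> A u p)"
      by (simp add: P_def tv F)
    then show "p \<in> P ` (UNIV \<times> UNIV \<times> J)" using p by blast
  next
    fix p assume "p \<in> P ` (UNIV \<times> UNIV \<times> J)"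
    then obtain t w r where "r \<in> J" and p: "p = P (t, w, r)" by auto
    moreover have "F_fun \<theta> \<xi> A u p = r"
      using mm by (simp add: p P_def F inner_add_left)
    ultimately show "p \<in> F_fun \<theta> \<xi> A u -` J" by simp
  qed
  ultimately show "connected (F_fun \<theta> \<xi> A u -` J)" by simp
  show "F_fun \<theta> \<xi> A u -` J \<noteq> {}" using J img by auto
qed

section \<open>The case \<open>transpose A *v u = 0\<close>\<close>

lemma transpose_eigenvector_of_commuting:
  fixes A \<theta> :: "real^2^2"
  assumes comm: "A ** \<theta> = \<theta> ** A" and "A \<noteq> 0" and "u \<noteq> 0"
    and range: "\<And>w. (A *v w) \<bullet> u = 0"
  obtains \<mu> where "\<And>w. (\<theta> *v w) \<bullet> u = \<mu> * (w \<bullet> u)"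
proof
  fix w
  obtain z where z: "A *v z \<noteq> 0"
    using \<open>A \<noteq> 0\<close> by (metis matrix_eq matrix_vector_mult_0)
  \<comment> \<open>The part of \<open>w\<close> orthogonal to \<open>u\<close>; it lies in the
    range of \<open>A\<close>, since \<open>A *v z\<close> spans that line.\<close>
  define w' where "w' = w - ((w \<bullet> u) / (u \<bullet> u)) *\<^sub>R u"
  have "w' \<bullet> u = 0" using \<open>u \<noteq> 0\<close> by (simp add: w'_def inner_diff_left)
  then obtain d where "w' = d *\<^sub>R (A *v z)"
    using parallel_if_orthogonal [OF \<open>u \<noteq> 0\<close> z range] by metis
  \<comment> \<open>Commutation puts \<open>\<theta> *v w'\<close> back into the range of
    \<open>A\<close>.\<close>
  then have "\<theta> *v w' = A *v (d *\<^sub>R (\<theta> *v z))"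
    using comm by (simp add: matrix_vector_mult_scaleR matrix_vector_mul_assoc)
  then have "(\<theta> *v w') \<bullet> u = 0" using range by simp
  \<comment> \<open>Only the component of \<open>w\<close> along \<open>u\<close> is left, so
    \<open>\<mu>\<close> is the Rayleigh quotient of \<open>\<theta>\<close> at
    \<open>u\<close>.\<close>
  then show "(\<theta> *v w) \<bullet> u = ((\<theta> *v u) \<bullet> u) / (u \<bullet> u) * (w \<bullet> u)"
    by (simp add: w'_def matrix_vector_mult_diff_distrib matrix_vector_mult_scaleR inner_diff_left)
qed

text \<open>If \<open>\<xi>\<close> were orthogonal to \<open>u\<close>, \<open>\<Delta>\<close>
  would be a subalgebra preserved by the derivation, against the rank condition.\<close>

lemma larc_imp_transversal:
  assumes sub: "subspace \<Delta>" and larc: "larc \<theta> \<xi> A \<Delta>"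
    and l: "l_line \<Delta> = {w. w \<bullet> u = 0}"
    and range: "\<And>w. (A *v w) \<bullet> u = 0"
    and eigen: "\<And>w. (\<theta> *v w) \<bullet> u = \<mu> * (w \<bullet> u)"
  shows "\<xi> \<bullet> u \<noteq> 0"
proof
  assume \<xi>: "\<xi> \<bullet> u = 0"
  have mem: "(0, w) \<in> \<Delta> \<longleftrightarrow> w \<bullet> u = 0" for w
    using l by (auto simp: l_line_def)
  have "lie_bracket \<theta> X Y \<in> \<Delta>" if "X \<in> \<Delta>" "Y \<in> \<Delta>" for X Y
  proof -
    \<comment> \<open>The first coordinates cancel, so the second component lies in
      \<open>l_line \<Delta>\<close>; the bracket is \<open>\<theta>\<close> applied to it.\<close>
    have "fst X *\<^sub>R Y - fst Y *\<^sub>R X \<in> \<Delta>"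
      using sub that by (intro subspace_diff subspace_scale)
    moreover have "fst X *\<^sub>R Y - fst Y *\<^sub>R X = (0, fst X *\<^sub>R snd Y - fst Y *\<^sub>R snd X)"
      by (simp add: prod_eq_iff)
    ultimately have "(fst X *\<^sub>R snd Y - fst Y *\<^sub>R snd X) \<bullet> u = 0"
      by (simp add: mem)
    then have "\<mu> * ((fst X *\<^sub>R snd Y - fst Y *\<^sub>R snd X) \<bullet> u) = 0" by simp
    then show ?thesis
      unfolding lie_bracket_def mem by (simp add: inner_diff_left eigen algebra_simps)
  qed
  then have "subalgebra \<theta> \<Delta>" using sub by (simp add: subalgebra_def)
  moreover have "lin_deriv \<xi> A ` \<Delta> \<subseteq> \<Delta>"
    by (auto simp: lin_deriv_def mem inner_add_left \<xi> range)
  ultimately show False using larc by (simp add: larc_def)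
qed

text \<open>The \<open>v\<close>-term vanishes, leaving a positive factor times \<open>h\<close>; by
  the mean value theorem and \<open>h 0 = 0\<close>, \<open>h t\<close> is \<open>t\<close> times a
  positive multiple of \<open>\<xi> \<bullet> u\<close>.\<close>

lemma sgn_F_fun_degenerate:
  assumes comm: "A ** \<theta> = \<theta> ** A"
    and m: "transpose A *v u = 0"
    and eigen: "\<And>w. (\<theta> *v w) \<bullet> u = \<mu> * (w \<bullet> u)"
  shows "sgn (F_fun \<theta> \<xi> A u (t, v)) = sgn (\<xi> \<bullet> u) * sgn t"
proof -
  define h where "h t = Lam \<theta> t \<xi> \<bullet> u" for t
  have D: "(h has_real_derivative exp (s * \<mu>) * (\<xi> \<bullet> u)) (at s)" for s
    unfolding h_def has_real_derivative_iff_has_vector_derivative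
    using bounded_linear.has_vector_derivative
      [OF bounded_linear_inner_left [of u] Lam_has_vector_derivative [of \<theta> \<xi> s]]
    by (simp add: rho_inner_eigen [OF eigen])
  have h0: "h 0 = 0" by (simp add: h_def)
  have F: "F_fun \<theta> \<xi> A u (t, v) = exp (- t * \<mu>) * h t"
    by (simp only: F_fun_eq [OF comm] m) (simp add: rho_inner_eigen [OF eigen] h_def)
  have MVT: "\<exists>z. h b - h a = (b - a) * (exp (z * \<mu>) * (\<xi> \<bullet> u))" if "a < b" for a b
    using MVT2 [OF that D] by blast
  consider "t = 0" | "t > 0" | "t < 0" by linarith
  then have "sgn (h t) = sgn (\<xi> \<bullet> u) * sgn t"
  proof cases
    case 2
    then obtain z where "h t = t * (exp (z * \<mu>) * (\<xi> \<bullet> u))" using MVT [of 0 t] h0 by auto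
    then show ?thesis by (simp add: sgn_mult)
  next
    case 3
    then obtain z where "h t = t * (exp (z * \<mu>) * (\<xi> \<bullet> u))" using MVT [of t 0] h0 by auto
    then show ?thesis by (simp add: sgn_mult)
  qed (simp add: h0)
  then show ?thesis by (simp add: F sgn_mult)
qed

lemma connected_vimage_F_fun_degenerate:
  assumes sgn: "\<And>t v. sgn (F_fun \<theta> \<xi> A u (t, v)) = sgn d * sgn t" and d: "d \<noteq> 0"
    and J: "J \<in> {{0}, {..<0}, {0<..}}"
  shows "connected (F_fun \<theta> \<xi> A u -` J)" "F_fun \<theta> \<xi> A u -` J \<noteq> {}"
proof -
  have zero: "F_fun \<theta> \<xi> A u (t, v) = 0 \<longleftrightarrow> t = 0" for t v
    using sgn [of t v] d by (metis mult_eq_0_iff sgn_zero_iff)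
  have pos: "F_fun \<theta> \<xi> A u (t, v) > 0 \<longleftrightarrow> d * t > 0" for t v
    using sgn [of t v] by (metis sgn_mult sgn_greater)
  have neg: "F_fun \<theta> \<xi> A u (t, v) < 0 \<longleftrightarrow> d * t < 0" for t v
    using sgn [of t v] by (metis sgn_mult sgn_less)
  \<comment> \<open>\<open>T\<close> is \<open>J\<close> for \<open>d > 0\<close>; for
    \<open>d < 0\<close> the two half-lines are interchanged.\<close>
  have "\<exists>T \<in> {{0}, {..<0}, {0<..}}. F_fun \<theta> \<xi> A u -` J = T \<times> UNIV"
    using J d by (cases "d > 0")
      (auto simp: zero pos neg zero_less_mult_iff mult_less_0_iff)
  then obtain T where T: "T \<in> {{0}, {..<0}, {0<..}}"
    and img: "F_fun \<theta> \<xi> A u -` J = T \<times> UNIV" by blast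
  have "connected T" using T by (auto simp: is_interval_connected)
  then show "connected (F_fun \<theta> \<xi> A u -` J)"
    unfolding img by (intro connected_Times connected_UNIV)
  show "F_fun \<theta> \<xi> A u -` J \<noteq> {}"
    unfolding img using T lt_ex [of "0::real"] gt_ex [of "0::real"] by auto
qed

section \<open>Components of the complement, and the conclusion\<close>

lemma components_nonzero:
  fixes f :: "'a::real_normed_vector \<Rightarrow> real"
  assumes "continuous_on UNIV f"
    and "connected (f -` {..<0})" "f -` {..<0} \<noteq> {}"
    and "connected (f -` {0<..})" "f -` {0<..} \<noteq> {}"
  shows "components (UNIV - f -` {0}) = {f -` {..<0}, f -` {0<..}}"
proof (rule components_open_unique)
  show "pairwise disjnt {f -` {..<0}, f -` {0<..}}"
    by (auto simp: pairwise_def disjnt_def)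
  have "open (f -` {..<0})" "open (f -` {0<..})"
    using assms(1) by (auto intro!: open_vimage)
  then show "open X \<and> connected X \<and> X \<noteq> {}" if "X \<in> {f -` {..<0}, f -` {0<..}}" for X
    using that assms by auto
qed auto

theorem theorem4p2:
  fixes \<theta> A :: "real^2^2" and \<xi> u :: "real^2"
    and \<Delta> :: "(real \<times> (real^2)) set"
    and g :: "real \<times> (real^2) \<Rightarrow> real \<times> (real^2) \<Rightarrow> real"
  assumes "admissible \<theta>"
    and "simple_ars \<theta> \<xi> A \<Delta> g"
    and "A \<noteq> 0"
    and "u \<noteq> 0"
    and "\<forall>w \<in> l_line \<Delta>. w \<bullet> u = 0"
  shows "connected (singular_locus \<theta> \<xi> A \<Delta>) \<and>
    components (UNIV - singular_locus \<theta> \<xi> A \<Delta>) =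
      {F_fun \<theta> \<xi> A u -` {..<0}, F_fun \<theta> \<xi> A u -` {0<..}} \<and>
    F_fun \<theta> \<xi> A u -` {..<0} \<noteq> F_fun \<theta> \<xi> A u -` {0<..}"
proof -
  have comm: "A ** \<theta> = \<theta> ** A" and sub: "subspace \<Delta>" and dim: "dim \<Delta> = 2"
    and larc: "larc \<theta> \<xi> A \<Delta>"
    using assms(2) by (auto simp: simple_ars_def)
  have l: "l_line \<Delta> = {w. w \<bullet> u = 0}"
    using l_line_eq_orthogonal [OF sub dim assms(4,5)] .
  have conn: "connected (F_fun \<theta> \<xi> A u -` J) \<and> F_fun \<theta> \<xi> A u -` J \<noteq> {}"
    if J: "J \<in> {{0}, {..<0}, {0<..}}" for J
  proof (cases "transpose A *v u = 0")
    case True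
    then have range: "(A *v w) \<bullet> u = 0" for w
      by (simp add: inner_transpose del: transpose_matrix_vector)
    obtain \<mu> where eigen: "\<And>w. (\<theta> *v w) \<bullet> u = \<mu> * (w \<bullet> u)"
      using transpose_eigenvector_of_commuting [OF comm assms(3,4) range] by blast
    have "\<xi> \<bullet> u \<noteq> 0"
      using larc_imp_transversal [OF sub larc l range eigen] .
    then show ?thesis
      using connected_vimage_F_fun_degenerate
        [OF sgn_F_fun_degenerate [OF comm True eigen] _ J] by simp
  next
    case False
    moreover have "connected J"
      using J by (auto simp: is_interval_connected)
    moreover have "J \<noteq> {}"
      using J lt_ex [of "0::real"] gt_ex [of "0::real"] by auto
    ultimately show ?thesis
      using connected_vimage_F_fun_regular [OF comm] by simp
  qed
  \<comment> \<open>Disjointness and nonemptiness ensure that the pair really lists two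
    components.\<close>
  have "F_fun \<theta> \<xi> A u -` {..<0} \<inter> F_fun \<theta> \<xi> A u -` {0<..} = {}" by auto
  then have "F_fun \<theta> \<xi> A u -` {..<0} \<noteq> F_fun \<theta> \<xi> A u -` {0<..}"
    using conn [of "{0<..}"] by auto
  moreover have "components (UNIV - F_fun \<theta> \<xi> A u -` {0}) =
      {F_fun \<theta> \<xi> A u -` {..<0}, F_fun \<theta> \<xi> A u -` {0<..}}"
    using conn by (intro components_nonzero continuous_on_F_fun) auto
  ultimately show ?thesis
    using conn [of "{0}"] by (simp add: singular_locus_eq_zeros [OF l])
qed

end
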